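(* Let $(\Omega,\rho)$ be a compact metric space equipped with a Borel probability measure $P$, containing the set $\mathbb{N}$ of non-negative integers as a dense subset. Let $\omega:\Omega\to[0,1]$ be a continuous function. Suppose that the sequence $\{n\}$ (of all elements of $\mathbb{N}$ in their natural order) is uniformly distributed in $\Omega$. Then the sequence $\{\omega(n)\}$ is $\pi$-uniformly measurable if and only if it is uniformly distributed modulo $1$.
   Context: For $S\subset\mathbb{N}$ put $\pi^\ast(S)=P(cl(S))$, where $cl$ is the closure in $\Omega$. Let $\mathcal{Y}$ be the system of all $A\subset\mathbb{N}$ with $\pi^\ast(A)+\pi^\ast(\mathbb{N}\setminus A)=1$, and let $\pi=\pi^\ast|_{\mathcal{Y}}$. A mapping (sequence) $x:\mathbb{N}\to[0,1]$ is $\pi$-uniformly measurable if for each subinterval $I\subset[0,1]$ the set $x^{-1}(I)$ belongs to $\mathcal{Y}$ and $\pi(x^{-1}(I))=|I|$, the length of $I$. A sequence $\{a_n\}$ of elements of $\Omega$ is uniformly distributed in $\Omega$ if $\lim_{N\to\infty}\frac1N\sum_{n=1}^N g(a_n)=\int g\,dP$ for every continuous real function $g$ on $\Omega$. A sequence $\{x_n\}$ of elements of $[0,1]$ is uniformly distributed modulo $1$ if for each subinterval $I\subset[0,1]$ the set $\{n: x_n\in I\}$ has asymptotic density equal to $|I|$, where the asymptotic density of $A\subset\mathbb{N}$ is $\lim_{n\to\infty}\frac1n|\{k\le n:k\in A\}|$ (if it exists). *)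

theory Defs
  imports "HOL-Probability.Probability"
begin

text \<open>
  The compact metric space is a type \<open>'a :: metric_space\<close> whose universe is compact; the inclusion
  of the natural numbers into it is an injection \<open>\<iota> :: nat \<Rightarrow> 'a\<close>.
\<close>

definition closure_measure :: "(nat \<Rightarrow> 'a::topological_space) \<Rightarrow> 'a measure \<Rightarrow> nat set \<Rightarrow> real" where
  "closure_measure \<iota> P S = measure P (closure (\<iota> ` S))"

definition pi_sets :: "(nat \<Rightarrow> 'a::topological_space) \<Rightarrow> 'a measure \<Rightarrow> nat set set" where
  "pi_sets \<iota> P = {A. closure_measure \<iota> P A + closure_measure \<iota> P (UNIV - A) = 1}"

definition pi_measure :: "(nat \<Rightarrow> 'a::topological_space) \<Rightarrow> 'a measure \<Rightarrow> nat set \<Rightarrow> real" where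
  "pi_measure \<iota> P = restrict (closure_measure \<iota> P) (pi_sets \<iota> P)"

text \<open>
  Subintervals of \<open>[0,1]\<close> may be open, closed, half-open, or degenerate.
\<close>

definition pi_uniformly_measurable ::
    "(nat \<Rightarrow> 'a::topological_space) \<Rightarrow> 'a measure \<Rightarrow> (nat \<Rightarrow> real) \<Rightarrow> bool" where
  "pi_uniformly_measurable \<iota> P x \<longleftrightarrow>
     range x \<subseteq> {0..1} \<and>
     (\<forall>I. is_interval I \<and> I \<subseteq> {0..1} \<longrightarrow>
        x -` I \<in> pi_sets \<iota> P \<and> pi_measure \<iota> P (x -` I) = measure lborel I)"

text \<open>
  Sequences are indexed from 0, so the first \<open>N\<close> terms are those with index below \<open>N\<close>.
\<close>

definition uniformly_distributed_in :: "'a::topological_space measure \<Rightarrow> (nat \<Rightarrow> 'a) \<Rightarrow> bool" where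
  "uniformly_distributed_in P a \<longleftrightarrow>
     (\<forall>g :: 'a \<Rightarrow> real. continuous_on UNIV g \<longrightarrow>
        (\<lambda>N. (\<Sum>n<N. g (a n)) / real N) \<longlonglongrightarrow> (LINT z|P. g z))"

definition has_asymptotic_density :: "nat set \<Rightarrow> real \<Rightarrow> bool" where
  "has_asymptotic_density A d \<longleftrightarrow> (\<lambda>n. real (card {k. k \<le> n \<and> k \<in> A}) / real n) \<longlonglongrightarrow> d"

definition uniformly_distributed_mod1 :: "(nat \<Rightarrow> real) \<Rightarrow> bool" where
  "uniformly_distributed_mod1 x \<longleftrightarrow>
     range x \<subseteq> {0..1} \<and>
     (\<forall>I. is_interval I \<and> I \<subseteq> {0..1} \<longrightarrow>
        has_asymptotic_density {n. x n \<in> I} (measure lborel I))"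

end

theory Submission imports Defs begin

text \<open>
  Both properties are equivalent to the one-sided bound \<open>P (\<omega>\<inverse>[a,b]) \<le> b - a\<close> for all \<open>a \<le> b\<close>.
  The bound follows from \<open>\<pi>\<close>-measurability by slightly enlarging \<open>[a,b]\<close> to a relatively open
  interval, whose preimage lies in the closure of its trace on the dense sequence, and from
  uniform distribution by testing against a continuous bump function.
  Conversely, the bound controls an interval with endpoints \<open>a, b\<close> from above, and its
  complement, contained in \<open>[0,a] \<union> [b,1]\<close>, by \<open>1 - (b - a)\<close>; as the two total masses add up to
  at least \<open>1\<close>, all these upper bounds are attained.
\<close>

section \<open>Subintervals of the unit interval, densities as averages, bump functions\<close>

lemma interval_length_le:
  fixes J :: "real set"
  assumes "is_interval J" "J \<subseteq> {a..b}" "a \<le> b"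
  shows "measure lborel J \<le> b - a"
proof -
  have "measure lborel J \<le> measure lborel (cbox a b)"
    using assms fmeasurable_cbox[of a b] real_interval_borel_measurable
    by (intro measure_mono_fmeasurable) simp_all
  then show ?thesis using assms(3) by simp
qed

text \<open>The endpoints are \<open>Inf I\<close> and \<open>Sup I\<close>, or \<open>0\<close>
  twice for the empty set. Trapping \<open>I\<close> between the open and the closed interval spares
  any case split on which endpoints belong to it, as both have length \<open>b - a\<close>.\<close>

lemma unit_subinterval_endpoints:
  fixes I :: "real set"
  assumes "is_interval I" "I \<subseteq> {0..1}"
  obtains a b where "0 \<le> a" "a \<le> b" "b \<le> 1" "{a<..<b} \<subseteq> I" "I \<subseteq> {a..b}"
    "measure lborel I = b - a"
proof -
  have "\<exists>a b. 0 \<le> a \<and> a \<le> b \<and> b \<le> 1 \<and> {a<..<b} \<subseteq> I \<and> I \<subseteq> {a..b}"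
  proof (cases "I = {}")
    case True
    then show ?thesis by (intro exI[of _ 0]) auto
  next
    case False
    have bdd: "bdd_below I" "bdd_above I"
      using assms(2) by (meson bdd_above_Icc bdd_above_mono bdd_below_Icc bdd_below_mono)+
    have "{Inf I<..<Sup I} \<subseteq> I"
    proof
      fix t assume "t \<in> {Inf I<..<Sup I}"
      then obtain u v where "u \<in> I" "v \<in> I" "u < t" "t < v"
        using False bdd by (auto simp: cInf_less_iff less_cSup_iff)
      then show "t \<in> I"
        using assms(1) by (meson is_interval_1 less_imp_le)
    qed
    moreover have "I \<subseteq> {Inf I..Sup I}"
      using bdd by (auto intro: cInf_lower cSup_upper)
    moreover have "0 \<le> Inf I" "Sup I \<le> 1"
      using False assms(2) by (force intro: cInf_greatest cSup_least)+
    moreover have "Inf I \<le> Sup I"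
      using False bdd by (meson all_not_in_conv cInf_lower cSup_upper order_trans)
    ultimately show ?thesis by blast
  qed
  then obtain a b where ab: "0 \<le> a" "a \<le> b" "b \<le> 1" "{a<..<b} \<subseteq> I" "I \<subseteq> {a..b}"
    by blast
  have "I \<in> fmeasurable lborel"
    by (rule fmeasurableI2[OF fmeasurable_cbox[of a b]])
      (use ab assms(1) in \<open>auto simp: real_interval_borel_measurable\<close>)
  then have "measure lborel {a<..<b} \<le> measure lborel I"
    using ab(4) by (intro measure_mono_fmeasurable) auto
  then have "measure lborel I = b - a"
    using ab interval_length_le[OF assms(1)] by fastforce
  then show thesis using that ab by blast
qed

text \<open>The definition counts the \<open>n + 1\<close> indices up to \<open>n\<close> but
  divides by \<open>n\<close>. The surplus term \<open>indicator A n / real n\<close> tends to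
  \<open>0\<close>, so the density is a limit of averages of the same shape as in
  \<open>uniformly_distributed_in\<close>.\<close>

lemma has_asymptotic_density_iff:
  "has_asymptotic_density A d \<longleftrightarrow> (\<lambda>N. (\<Sum>n<N. indicator A n) / real N) \<longlonglongrightarrow> d"
proof -
  have eq: "real (card {k. k \<le> n \<and> k \<in> A}) / real n =
      (\<Sum>k<n. indicator A k) / real n + indicator A n / real n" for n
  proof -
    have "real (card {k. k \<le> n \<and> k \<in> A}) = (\<Sum>k\<le>n. indicator A k)"
      by (simp add: indicator_def sum.If_cases Int_def)
    then show ?thesis
      by (simp add: add_divide_distrib flip: lessThan_Suc_atMost)
  qed
  have "(\<lambda>n. indicator A n / real n) \<longlonglongrightarrow> 0"
    by (rule Lim_null_comparison[OF _ lim_1_over_n])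
      (auto intro!: always_eventually divide_right_mono simp: indicator_def)
  then have "(\<lambda>n. u n + indicator A n / real n) \<longlonglongrightarrow> d \<longleftrightarrow> u \<longlonglongrightarrow> d" for u :: "nat \<Rightarrow> real"
    using tendsto_add[of u d sequentially "\<lambda>n. indicator A n / real n" 0]
      tendsto_diff[of "\<lambda>n. u n + indicator A n / real n" d sequentially "\<lambda>n. indicator A n / real n" 0]
    by auto
  then show ?thesis
    unfolding has_asymptotic_density_def eq by simp
qed

lemma interval_bump_function:
  fixes a b \<delta> :: real
  assumes "\<delta> > 0"
  obtains f :: "real \<Rightarrow> real" where "continuous_on UNIV f"
    "\<And>t. indicator {a..b} t \<le> f t" "\<And>t. f t \<le> indicator {a - \<delta>..b + \<delta>} t"
proof
  \<comment> \<open>For \<open>a \<le> b\<close> the sum of the two inner maxima is the distance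
    from \<open>t\<close> to \<open>{a..b}\<close>, so the graph is a trapezoid of height 1 with
    flanks of slope \<open>1 / \<delta>\<close>.\<close>
  let ?f = "\<lambda>t. max 0 (1 - (max 0 (a - t) + max 0 (t - b)) / \<delta>)"
  show "continuous_on UNIV ?f"
    using assms by (intro continuous_intros) auto
  show "indicator {a..b} t \<le> ?f t" for t
    by (auto simp: indicator_def)
  show "?f t \<le> indicator {a - \<delta>..b + \<delta>} t" for t
    using assms by (auto simp: indicator_def field_simps max_def)
qed

section \<open>The observable \<omega> and its integrals against bump functions\<close>

locale distributed_observable = prob_space P for P :: "'a::metric_space measure" +
  fixes \<iota> :: "nat \<Rightarrow> 'a" and \<omega> :: "'a \<Rightarrow> real"
  assumes borel: "sets P = sets borel"
    and dense: "closure (range \<iota>) = UNIV"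
    and cont: "continuous_on UNIV \<omega>"
    and range: "range \<omega> \<subseteq> {0..1}"
    and ud: "uniformly_distributed_in P \<iota>"
begin

text \<open>The endpoints range over all reals, so that an interval enlarged beyond
  \<open>{0..1}\<close> can be used without clipping.\<close>

definition interval_bounded :: bool where
  "interval_bounded \<longleftrightarrow> (\<forall>a b. a \<le> b \<longrightarrow> measure P (\<omega> -` {a..b}) \<le> b - a)"

lemma space_eq [simp]: "space P = UNIV"
  using sets_eq_imp_space_eq[OF borel] by simp

lemma measurable_obs [measurable]: "\<omega> \<in> borel_measurable P"
  using borel_measurable_continuous_onI[OF cont] borel measurable_cong_sets by blast

lemma vimage_sets [intro]: "B \<in> sets borel \<Longrightarrow> \<omega> -` B \<in> sets P"
  using measurable_sets[OF measurable_obs] by simp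

lemma closed_sets [intro]: "closed C \<Longrightarrow> C \<in> sets P"
  by (simp add: borel)

lemma obs_range: "0 \<le> \<omega> z" "\<omega> z \<le> 1"
  using range by (auto simp: image_subset_iff)

text \<open>The integral of a bump is the link between the two sides: it is squeezed between
  measures of preimages, and by uniform distribution in \<Omega> it is the limit of averages along
  the sequence.\<close>

lemma bump_integral_bounds:
  assumes f: "continuous_on UNIV f" "\<And>t. indicator {a..b} t \<le> f t"
    "\<And>t. f t \<le> indicator {c..d} t"
  shows "measure P (\<omega> -` {a..b}) \<le> (LINT z|P. f (\<omega> z))"
    "(LINT z|P. f (\<omega> z)) \<le> measure P (\<omega> -` {c..d})"
    "(\<lambda>N. (\<Sum>n<N. f (\<omega> (\<iota> n))) / real N) \<longlonglongrightarrow> (LINT z|P. f (\<omega> z))"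
proof -
  have f01: "0 \<le> f t" "f t \<le> 1" for t
    using order_trans[OF _ f(2)[of t], of 0] order_trans[OF f(3)[of t], of 1]
    by (auto simp: indicator_def)
  have comp: "continuous_on UNIV (\<lambda>z. f (\<omega> z))"
    using continuous_on_compose2[OF f(1) cont] by simp
  have [measurable]: "f \<in> borel_measurable borel"
    using f(1) by (rule borel_measurable_continuous_onI)
  have int: "integrable P (\<lambda>z. f (\<omega> z))"
    by (rule integrable_const_bound[of _ 1]) (use f01 in auto)
  have ind: "measure P (\<omega> -` S) = (LINT z|P. indicator S (\<omega> z))"
       "integrable P (\<lambda>z. indicator S (\<omega> z) :: real)" if "S \<in> sets borel" for S
  proof -
    have "(\<lambda>z. indicator S (\<omega> z) :: real) = indicator (\<omega> -` S)"
      by (auto simp: indicator_def)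
    then show "measure P (\<omega> -` S) = (LINT z|P. indicator S (\<omega> z))"
       "integrable P (\<lambda>z. indicator S (\<omega> z) :: real)"
      using vimage_sets[OF that] by (simp_all add: emeasure_eq_measure)
  qed
  show "measure P (\<omega> -` {a..b}) \<le> (LINT z|P. f (\<omega> z))"
    "(LINT z|P. f (\<omega> z)) \<le> measure P (\<omega> -` {c..d})"
    using f by (auto simp: ind intro!: integral_mono int ind)
  show "(\<lambda>N. (\<Sum>n<N. f (\<omega> (\<iota> n))) / real N) \<longlonglongrightarrow> (LINT z|P. f (\<omega> z))"
    using ud comp unfolding uniformly_distributed_in_def by blast
qed

section \<open>From each of the two properties to the bound\<close>

lemma interval_boundedI:
  assumes "\<And>a b \<delta>. a \<le> b \<Longrightarrow> \<delta> > 0 \<Longrightarrow> measure P (\<omega> -` {a..b}) \<le> b - a + 2 * \<delta>"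
  shows interval_bounded
  unfolding interval_bounded_def
proof (intro allI impI)
  fix a b :: real assume "a \<le> b"
  show "measure P (\<omega> -` {a..b}) \<le> b - a"
  proof (rule field_le_epsilon)
    fix e :: real assume "0 < e"
    \<comment> \<open>Moving both ends outwards by \<delta> adds \<open>2 * \<delta>\<close> to the
      length, hence \<delta> is half of \<open>e\<close>.\<close>
    then show "measure P (\<omega> -` {a..b}) \<le> b - a + e"
      using assms[of a b "e / 2"] \<open>a \<le> b\<close> by simp
  qed
qed

lemma pi_imp_interval_bounded:
  assumes "pi_uniformly_measurable \<iota> P (\<lambda>n. \<omega> (\<iota> n))"
  shows interval_bounded
proof (rule interval_boundedI)
  fix a b \<delta> :: real assume ab: "a \<le> b" "\<delta> > 0"
  define J where "J = {a - \<delta><..<b + \<delta>} \<inter> {0..1}"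
  define U where "U = \<omega> -` {a - \<delta><..<b + \<delta>}"
  define A where "A = (\<lambda>n. \<omega> (\<iota> n)) -` J"
  have J: "is_interval J" "J \<subseteq> {0..1}"
    by (auto simp: J_def is_interval_1)
  have "open U"
    unfolding U_def by (rule open_vimage[OF open_greaterThanLessThan cont])
  \<comment> \<open>An open set lies in the closure of its trace on a dense set. A closed set such
    as the preimage of \<open>{a..b}\<close> need not, which is why the interval was first enlarged
    to an open one.\<close>
  have "U \<subseteq> closure (U \<inter> range \<iota>)"
    using open_Int_closure_subset[OF \<open>open U\<close>, of "range \<iota>"] dense by simp
  also have "U \<inter> range \<iota> = \<iota> ` A"
    using obs_range by (auto simp: U_def A_def J_def)
  finally have UA: "U \<subseteq> closure (\<iota> ` A)" .
  have "measure P (\<omega> -` {a..b}) \<le> measure P (closure (\<iota> ` A))"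
    by (rule finite_measure_mono) (use UA ab in \<open>force simp: U_def\<close>, simp add: borel)
  also have "\<dots> = measure lborel J"
  proof -
    have "A \<in> pi_sets \<iota> P" "pi_measure \<iota> P A = measure lborel J"
      using assms J unfolding pi_uniformly_measurable_def A_def by blast+
    then show ?thesis
      by (simp add: pi_measure_def closure_measure_def)
  qed
  also have "\<dots> \<le> (b + \<delta>) - (a - \<delta>)"
    by (rule interval_length_le) (use J ab in \<open>auto simp: J_def\<close>)
  finally show "measure P (\<omega> -` {a..b}) \<le> b - a + 2 * \<delta>"
    by simp
qed

lemma ud_imp_interval_bounded:
  assumes "uniformly_distributed_mod1 (\<lambda>n. \<omega> (\<iota> n))"
  shows interval_bounded
proof (rule interval_boundedI)
  fix a b \<delta> :: real assume ab: "a \<le> b" "\<delta> > 0"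
  define J where "J = {a - \<delta>..b + \<delta>} \<inter> {0..1}"
  have J: "is_interval J" "J \<subseteq> {0..1}"
    by (auto simp: J_def is_interval_1)
  obtain f :: "real \<Rightarrow> real" where f: "continuous_on UNIV f" "\<And>t. indicator {a..b} t \<le> f t"
    "\<And>t. f t \<le> indicator {a - \<delta>..b + \<delta>} t"
    by (rule interval_bump_function[OF ab(2), of a b]) blast
  note bump = bump_integral_bounds[OF f]
  have "(\<lambda>N. (\<Sum>n<N. indicator {n. \<omega> (\<iota> n) \<in> J} n) / real N) \<longlonglongrightarrow> measure lborel J"
    using assms J unfolding uniformly_distributed_mod1_def has_asymptotic_density_iff by blast
  \<comment> \<open>Cutting the enlarged interval down to \<open>J\<close> loses nothing, since
    \<omega> takes its values in \<open>{0..1}\<close>.\<close>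
  moreover have "f (\<omega> (\<iota> n)) \<le> indicator {n. \<omega> (\<iota> n) \<in> J} n" for n
    using f(3)[of "\<omega> (\<iota> n)"] obs_range[of "\<iota> n"] by (auto simp: indicator_def J_def)
  ultimately have "(LINT z|P. f (\<omega> z)) \<le> measure lborel J"
    using bump(3) by (intro LIMSEQ_le[of _ _ "\<lambda>N. (\<Sum>n<N. indicator {n. \<omega> (\<iota> n) \<in> J} n) / real N"])
      (auto intro!: exI[of _ 0] divide_right_mono sum_mono)
  also have "\<dots> \<le> (b + \<delta>) - (a - \<delta>)"
    by (rule interval_length_le) (use J ab in \<open>auto simp: J_def\<close>)
  finally show "measure P (\<omega> -` {a..b}) \<le> b - a + 2 * \<delta>"
    using bump(1) by simp
qed

section \<open>From the bound back to each of the two properties\<close>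

lemma interval_bounded_imp_pi:
  assumes interval_bounded
  shows "pi_uniformly_measurable \<iota> P (\<lambda>n. \<omega> (\<iota> n))"
  unfolding pi_uniformly_measurable_def
proof (intro conjI allI impI)
  show "range (\<lambda>n. \<omega> (\<iota> n)) \<subseteq> {0..1}"
    using obs_range by auto
next
  fix I :: "real set" assume "is_interval I \<and> I \<subseteq> {0..1}"
  then obtain a b where ab: "0 \<le> a" "a \<le> b" "b \<le> 1" "{a<..<b} \<subseteq> I" "I \<subseteq> {a..b}"
    "measure lborel I = b - a"
    using unit_subinterval_endpoints by metis
  define A where "A = (\<lambda>n. \<omega> (\<iota> n)) -` I"
  have bound: "measure P (\<omega> -` {c..d}) \<le> d - c" if "c \<le> d" for c d
    using assms that by (simp add: interval_bounded_def)
  have cl: "closed (\<omega> -` {c..d})" for c d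
    using cont by (simp add: closed_vimage)
  have "closure (\<iota> ` A) \<subseteq> \<omega> -` {a..b}"
    by (rule closure_minimal[OF _ cl]) (use ab in \<open>auto simp: A_def\<close>)
  then have le1: "measure P (closure (\<iota> ` A)) \<le> b - a"
    using bound[of a b] ab finite_measure_mono[of "closure (\<iota> ` A)" "\<omega> -` {a..b}"] by fastforce
  \<comment> \<open>A value outside \<open>I\<close> avoids the open interval between
    \<open>a\<close> and \<open>b\<close>, so it lies in one of two closed intervals of total length
    \<open>1 - (b - a)\<close>.\<close>
  have "closure (\<iota> ` (UNIV - A)) \<subseteq> \<omega> -` {0..a} \<union> \<omega> -` {b..1}"
    by (rule closure_minimal[OF _ closed_Un[OF cl cl]])
      (use ab obs_range in \<open>force simp: A_def\<close>)
  then have "measure P (closure (\<iota> ` (UNIV - A))) \<le> measure P (\<omega> -` {0..a} \<union> \<omega> -` {b..1})"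
    by (rule finite_measure_mono) (intro sets.Un vimage_sets, simp_all)
  also have "\<dots> \<le> measure P (\<omega> -` {0..a}) + measure P (\<omega> -` {b..1})"
    by (rule measure_Un_le) auto
  finally have le2: "measure P (closure (\<iota> ` (UNIV - A))) \<le> 1 - (b - a)"
    using bound[of 0 a] bound[of b 1] ab by simp
  \<comment> \<open>Density makes the two closures cover the space. Their measures sum to at least 1
    while the upper bounds \<open>le1\<close> and \<open>le2\<close> sum to exactly 1, so both
    bounds are equalities.\<close>
  have "closure (\<iota> ` A) \<union> closure (\<iota> ` (UNIV - A)) = UNIV"
    using dense by (simp flip: closure_Un image_Un)
  then have "1 \<le> measure P (closure (\<iota> ` A)) + measure P (closure (\<iota> ` (UNIV - A)))"
    using measure_Un_le[of "closure (\<iota> ` A)" P "closure (\<iota> ` (UNIV - A))"] prob_space by auto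
  with le1 le2 have "measure P (closure (\<iota> ` A)) = b - a"
    "measure P (closure (\<iota> ` (UNIV - A))) = 1 - (b - a)"
    by linarith+
  then show "(\<lambda>n. \<omega> (\<iota> n)) -` I \<in> pi_sets \<iota> P"
    "pi_measure \<iota> P ((\<lambda>n. \<omega> (\<iota> n)) -` I) = measure lborel I"
    using ab(6) by (simp_all add: pi_measure_def pi_sets_def closure_measure_def flip: A_def)
qed

text \<open>The same squeeze is carried out on the frequencies \<open>F S N\<close> of values in
  \<open>S\<close> among the first \<open>N\<close> terms, with upper bounds that hold eventually,
  up to a small error.\<close>

lemma interval_bounded_imp_ud:
  assumes interval_bounded
  shows "uniformly_distributed_mod1 (\<lambda>n. \<omega> (\<iota> n))"
  unfolding uniformly_distributed_mod1_def has_asymptotic_density_iff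
proof (intro conjI allI impI)
  show "range (\<lambda>n. \<omega> (\<iota> n)) \<subseteq> {0..1}"
    using obs_range by auto
next
  define F where "F S N = (\<Sum>n<N. indicator S (\<omega> (\<iota> n))) / real N" for S :: "real set" and N
  have upper: "\<forall>\<^sub>F N in sequentially. F {a..b} N < b - a + e" if "a \<le> b" "e > 0" for a b e
  proof -
    \<comment> \<open>Enlarging by \<open>e / 3\<close> on each side costs \<open>2 * e / 3\<close>,
      which leaves the strict inequality needed to pass from the limit to the averages.\<close>
    have "e / 3 > 0" using that(2) by simp
    obtain f :: "real \<Rightarrow> real" where f: "continuous_on UNIV f" "\<And>t. indicator {a..b} t \<le> f t"
      "\<And>t. f t \<le> indicator {a - e / 3..b + e / 3} t"
      by (rule interval_bump_function[OF \<open>e / 3 > 0\<close>, of a b]) blast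
    note bump = bump_integral_bounds[OF f]
    have "measure P (\<omega> -` {a - e / 3..b + e / 3}) \<le> (b + e / 3) - (a - e / 3)"
      using that by (intro assms[unfolded interval_bounded_def, rule_format]) simp
    then have "(LINT z|P. f (\<omega> z)) < b - a + e"
      using bump(2) that(2) by linarith
    with bump(3) have "\<forall>\<^sub>F N in sequentially. (\<Sum>n<N. f (\<omega> (\<iota> n))) / real N < b - a + e"
      by (rule order_tendstoD(2))
    moreover have "F {a..b} N \<le> (\<Sum>n<N. f (\<omega> (\<iota> n))) / real N" for N
      unfolding F_def by (intro divide_right_mono sum_mono f(2)) simp
    ultimately show ?thesis
      by (elim eventually_mono) (rule le_less_trans)
  qed
  fix I :: "real set" assume "is_interval I \<and> I \<subseteq> {0..1}"
  then obtain a b where ab: "0 \<le> a" "a \<le> b" "b \<le> 1" "{a<..<b} \<subseteq> I" "I \<subseteq> {a..b}"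
    "measure lborel I = b - a"
    using unit_subinterval_endpoints by metis
  have le: "F I N \<le> F {a..b} N" for N
    unfolding F_def
    by (intro divide_right_mono sum_mono) (use ab(5) in \<open>auto simp: indicator_def\<close>)
  \<comment> \<open>The three sets cover \<open>{0..1}\<close>, possibly overlapping at
    \<open>a\<close> and \<open>b\<close>. At \<open>N = 0\<close> the quotients are 0 and the
    inequality fails.\<close>
  have ge: "1 \<le> F I N + F {0..a} N + F {b..1} N" if "N > 0" for N
  proof -
    have "real N = (\<Sum>n<N. 1)" by simp
    also have "\<dots> \<le> (\<Sum>n<N. indicator I (\<omega> (\<iota> n)) + indicator {0..a} (\<omega> (\<iota> n)) +
        indicator {b..1} (\<omega> (\<iota> n)))"
      by (rule sum_mono) (use ab(4) obs_range in \<open>force simp: indicator_def\<close>)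
    finally show ?thesis
      using that by (simp add: F_def sum.distrib field_simps)
  qed
  have "F I \<longlonglongrightarrow> b - a"
  proof (rule tendstoI)
    fix e :: real assume "e > 0"
    \<comment> \<open>The lower estimate of \<open>F I N\<close> subtracts two frequencies from 1,
      each with its own error, so each may use half of \<open>e\<close>.\<close>
    then have "e / 2 > 0" by simp
    note up = upper[OF _ this]
    show "\<forall>\<^sub>F N in sequentially. dist (F I N) (b - a) < e"
      using up[OF ab(2)] up[OF ab(1)] up[OF ab(3)] eventually_gt_at_top[of 0]
    proof eventually_elim
      case (elim N)
      then show ?case
        using le[of N] ge[of N] \<open>e > 0\<close> by (simp add: dist_real_def)
    qed
  qed
  moreover have "indicator I (\<omega> (\<iota> n)) = (indicator {n. \<omega> (\<iota> n) \<in> I} n :: real)" for n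
    by (simp add: indicator_def)
  ultimately show "(\<lambda>N. (\<Sum>n<N. indicator {n. \<omega> (\<iota> n) \<in> I} n) / real N) \<longlonglongrightarrow> measure lborel I"
    using ab(6) by (simp add: F_def[abs_def])
qed

end

theorem proposition2:
  fixes P :: "'a::metric_space measure"
    and \<iota> :: "nat \<Rightarrow> 'a"
    and \<omega> :: "'a \<Rightarrow> real"
  assumes compact: "compact (UNIV :: 'a set)"
    and prob: "prob_space P"
    and borel: "sets P = sets borel"
    and inj: "inj \<iota>"
    and dense: "closure (range \<iota>) = UNIV"
    and cont: "continuous_on UNIV \<omega>"
    and range: "range \<omega> \<subseteq> {0..1}"
    and ud: "uniformly_distributed_in P \<iota>"
  shows "pi_uniformly_measurable \<iota> P (\<lambda>n. \<omega> (\<iota> n)) \<longleftrightarrow>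
         uniformly_distributed_mod1 (\<lambda>n. \<omega> (\<iota> n))"
proof -
  interpret distributed_observable P \<iota> \<omega>
    by (intro distributed_observable.intro distributed_observable_axioms.intro
        prob borel dense cont range ud)
  show ?thesis
    using pi_imp_interval_bounded interval_bounded_imp_pi
      ud_imp_interval_bounded interval_bounded_imp_ud by blast
qed

end
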